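(* Let $M,N$ be positive integers and let $A$ be a strongly badly approximable $M\times N$ matrix in $G_1 = (\mathbb{R}/\mathbb{Z})^{MN}$. Then there is a constant $c = c(A) > 0$, depending only on $A$, such that for all nonnegative integers $K_1, K_2, \dots, K_N$, not all of which are zero, writing $$\mathcal{K} = \{\xi \in \mathbb{Z}^N : 0 \le \xi_n \le K_n \text{ for } n = 1, 2, \dots, N\},$$ we have $$\sum_{\substack{\xi \in \mathcal{K}\\ \xi \ne 0}} F(A\xi) \le c\, |\mathcal{K}| \bigl(\log 2|\mathcal{K}|\bigr)^M.$$
   Context: For $x \in \mathbb{R}/\mathbb{Z}$, $\|x\|$ is the distance from (any real representative of) $x$ to the nearest integer. Elements of $G_1 = (\mathbb{R}/\mathbb{Z})^{MN}$ are written as $M\times N$ matrices $A = (\alpha_{mn})$ with entries in $\mathbb{R}/\mathbb{Z}$; elements of $G_2 = (\mathbb{R}/\mathbb{Z})^M$ are written as column vectors. For a column vector $\xi \in \mathbb{Z}^N$, $A\xi = \bigl(\sum_{n=1}^N \alpha_{mn}\xi_n\bigr)_{1\le m\le M} \in G_2$. The function $F : G_2 \to [1,\infty]$ is $F(x) = \prod_{m=1}^M (2\|x_m\|)^{-1}$, with value $+\infty$ if some $\|x_m\|=0$. $|\mathcal{K}|$ denotes cardinality. $A = (\alpha_{mn})$ in $G_1$ is called strongly badly approximable if there exists a constant $\gamma(A) > 0$ such that $$\gamma(A) \le \left(\prod_{m=1}^M \Bigl\|\sum_{n=1}^N \alpha_{mn}\xi_n\Bigr\|\right)\left(\prod_{n=1}^N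 (|\xi_n|+1)\right)$$ for all $\xi \ne 0$ in $\mathbb{Z}^N$. *)

theory Defs
  imports "HOL-Analysis.Analysis"
begin

text \<open>The circle group \<open>\<real>/\<int>\<close> as an additive abelian group.\<close>

quotient_type circle = real / "\<lambda>x y. x - y \<in> \<int>"
proof (rule equivpI)
  show "reflp (\<lambda>x y :: real. x - y \<in> \<int>)"
    by (simp add: reflp_def)
  show "symp (\<lambda>x y :: real. x - y \<in> \<int>)"
    unfolding symp_def by (metis Ints_minus minus_diff_eq)
  show "transp (\<lambda>x y :: real. x - y \<in> \<int>)"
    unfolding transp_def by (metis Ints_add diff_add_cancel add_diff_eq)
qed

instantiation circle :: ab_group_add
begin

lift_definition zero_circle :: circle is "0 :: real" .

lift_definition plus_circle :: "circle \<Rightarrow> circle \<Rightarrow> circle" is "(+)"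
  by (metis Ints_add add_diff_add)

lift_definition uminus_circle :: "circle \<Rightarrow> circle" is uminus
  by (metis Ints_minus minus_diff_minus)

definition minus_circle :: "circle \<Rightarrow> circle \<Rightarrow> circle" where
  "minus_circle x y = x + - y"

instance
proof
  fix a b c :: circle
  show "a + b + c = a + (b + c)"
    by transfer (simp add: add.assoc)
  show "a + b = b + a"
    by transfer (simp add: add.commute)
  show "0 + a = a"
    by transfer simp
  show "- a + a = 0"
    by transfer simp
  show "a - b = a + - b"
    by (rule minus_circle_def)
qed

end

text \<open>The action of \<open>\<int>\<close> on \<open>\<real>/\<int>\<close> by integer multiples.\<close>

lift_definition int_scale :: "int \<Rightarrow> circle \<Rightarrow> circle" is "\<lambda>k x. of_int k * x"
  by (metis Ints_mult Ints_of_int right_diff_distrib)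

lift_definition circle_norm :: "circle \<Rightarrow> real" is "\<lambda>x. infdist x \<int>"
proof -
  fix x y :: real
  assume xy: "x - y \<in> \<int>"
  have "dist x ` \<int> = dist y ` \<int>"
  proof (intro equalityI image_subsetI)
    fix k :: real assume "k \<in> \<int>"
    show "dist x k \<in> dist y ` \<int>"
      by (rule image_eqI[of _ _ "k - (x - y)"])
        (use xy \<open>k \<in> \<int>\<close> in \<open>auto simp: dist_real_def\<close>)
    show "dist y k \<in> dist x ` \<int>"
      by (rule image_eqI[of _ _ "k + (x - y)"])
        (use xy \<open>k \<in> \<int>\<close> in \<open>auto simp: dist_real_def\<close>)
  qed
  then show "infdist x \<int> = infdist y \<int>"
    unfolding infdist_def by simp
qed

text \<open>An \<open>M \<times> N\<close> matrix over \<open>\<real>/\<int>\<close> has type \<open>circle ^ 'n ^ 'm\<close>, with \<open>M = CARD('m)\<close>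
  rows and \<open>N = CARD('n)\<close> columns.\<close>

definition matrix_act :: "circle ^ 'n ^ 'm \<Rightarrow> int ^ 'n \<Rightarrow> circle ^ 'm" where
  "matrix_act A \<xi> = (\<chi> m. \<Sum>n\<in>UNIV. int_scale (\<xi> $ n) (A $ m $ n))"

definition strongly_badly_approximable :: "circle ^ 'n ^ 'm \<Rightarrow> bool" where
  "strongly_badly_approximable A \<longleftrightarrow>
    (\<exists>\<gamma>>0. \<forall>\<xi> :: int ^ 'n. \<xi> \<noteq> 0 \<longrightarrow>
      \<gamma> \<le> (\<Prod>m\<in>UNIV. circle_norm (\<Sum>n\<in>UNIV. int_scale (\<xi> $ n) (A $ m $ n))) *
          (\<Prod>n\<in>UNIV. (real_of_int \<bar>\<xi> $ n\<bar> + 1)))"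

definition F :: "circle ^ 'm \<Rightarrow> ennreal" where
  "F x = (if \<exists>m. circle_norm (x $ m) = 0 then \<infinity>
          else ennreal (\<Prod>m\<in>UNIV. inverse (2 * circle_norm (x $ m))))"

definition int_box :: "nat ^ 'n \<Rightarrow> (int ^ 'n) set" where
  "int_box K = {\<xi>. \<forall>n. 0 \<le> \<xi> $ n \<and> \<xi> $ n \<le> int (K $ n)}"

end

theory Submission
  imports Defs
begin

text \<open>Let \<open>Q = |\<K>|\<close>. The difference of two distinct points of \<open>\<K>\<close> satisfies
  \<open>\<Prod>(|\<xi>\<^sub>n| + 1) \<le> Q\<close>, so the vectors \<open>A\<xi>\<close> are pairwise separated in the sense that
  \<open>\<Prod>\<parallel>x\<^sub>m - y\<^sub>m\<parallel> \<ge> \<delta> = \<gamma>/Q\<close>. Sort them into boxes according to the sign of each coordinate and the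
  integer part \<open>j\<^sub>m\<close> of \<open>-ln \<parallel>x\<^sub>m\<parallel>\<close>. Slicing such a box along one coordinate into pieces of volume
  \<open>\<delta>\<close> shows that it contains \<open>O(exp (- \<Sum>j\<^sub>m) / \<delta>)\<close> points, and \<open>F\<close> is
  \<open>O(exp (\<Sum>j\<^sub>m))\<close> there, so every box contributes \<open>O(Q)\<close>. Since \<open>exp (- \<Sum>j\<^sub>m) \<ge> \<delta>\<close>, only
  \<open>O((log 2Q)^M)\<close> boxes are occupied.\<close>

section \<open>Separated points in real boxes\<close>

text \<open>Project to one coordinate \<open>m0\<close>. The other differences have product at most
  \<open>P\<close>, so separation keeps the values \<open>f x m0\<close> at least
  \<open>\<delta> / P\<close> apart, and an interval of length \<open>2 * l m0\<close> has room for
  few of them.\<close>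

lemma card_separated_box_le:
  fixes f :: "'a \<Rightarrow> 'm::finite \<Rightarrow> real" and l :: "'m \<Rightarrow> real"
  assumes d: "\<delta> > 0" and l: "\<And>m. l m > 0" and dl: "\<delta> \<le> (\<Prod>m\<in>UNIV. l m)"
    and bd: "\<And>x m. x \<in> T \<Longrightarrow> \<bar>f x m\<bar> \<le> l m"
    and diff: "\<And>x y m. x \<in> T \<Longrightarrow> y \<in> T \<Longrightarrow> \<bar>f x m - f y m\<bar> \<le> l m"
    and sep: "\<And>x y. x \<in> T \<Longrightarrow> y \<in> T \<Longrightarrow> x \<noteq> y \<Longrightarrow> \<delta> \<le> (\<Prod>m\<in>UNIV. \<bar>f x m - f y m\<bar>)"
  shows "real (card T) \<le> 4 * (\<Prod>m\<in>UNIV. l m) / \<delta>"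
proof -
  fix m0 :: 'm
  define P where "P = (\<Prod>m\<in>UNIV - {m0}. l m)"
  have P: "P > 0" unfolding P_def by (simp add: l prod_pos)
  have lP: "(\<Prod>m\<in>UNIV. l m) = l m0 * P"
    unfolding P_def by (simp add: prod.remove)
  define X where "X = l m0 * P / \<delta>"
  have X: "X \<ge> 1" using dl d by (simp add: X_def lP)
  \<comment> \<open>Index of the slice of width \<open>\<delta> / P\<close> in coordinate
    \<open>m0\<close>; each slice holds at most one point.\<close>
  define h where "h x = \<lfloor>f x m0 * P / \<delta>\<rfloor>" for x
  have inj: "inj_on h T"
  proof (rule inj_onI, rule ccontr)
    fix x y assume xy: "x \<in> T" "y \<in> T" "h x = h y" "x \<noteq> y"
    have "\<bar>f x m0 * P / \<delta> - f y m0 * P / \<delta>\<bar> < 1"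
      using xy(3) unfolding h_def by linarith
    also have "f x m0 * P / \<delta> - f y m0 * P / \<delta> = (f x m0 - f y m0) * (P / \<delta>)"
      by (simp add: algebra_simps)
    also have "\<bar>(f x m0 - f y m0) * (P / \<delta>)\<bar> = \<bar>f x m0 - f y m0\<bar> * P / \<delta>"
      using P d by (simp add: abs_mult)
    finally have lt: "\<bar>f x m0 - f y m0\<bar> * P < \<delta>"
      using d by (simp add: divide_less_eq)
    have "\<delta> \<le> (\<Prod>m\<in>UNIV. \<bar>f x m - f y m\<bar>)" by (rule sep) (use xy in auto)
    also have "\<dots> = \<bar>f x m0 - f y m0\<bar> * (\<Prod>m\<in>UNIV - {m0}. \<bar>f x m - f y m\<bar>)"
      by (simp add: prod.remove)
    also have "\<dots> \<le> \<bar>f x m0 - f y m0\<bar> * P"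
      unfolding P_def by (intro mult_left_mono prod_mono) (use diff xy in auto)
    finally show False using lt by simp
  qed
  have "h ` T \<subseteq> {\<lfloor>-X\<rfloor>..\<lfloor>X\<rfloor>}"
  proof (intro image_subsetI)
    fix x assume "x \<in> T"
    then have "- l m0 \<le> f x m0" "f x m0 \<le> l m0" using bd[of x m0] by auto
    then have "- l m0 * (P / \<delta>) \<le> f x m0 * (P / \<delta>)" "f x m0 * (P / \<delta>) \<le> l m0 * (P / \<delta>)"
      using P d by (intro mult_right_mono; simp)+
    then have "- X \<le> f x m0 * P / \<delta>" "f x m0 * P / \<delta> \<le> X"
      by (simp_all add: X_def)
    then show "h x \<in> {\<lfloor>-X\<rfloor>..\<lfloor>X\<rfloor>}" by (auto simp: h_def floor_mono)
  qed
  then have "card T \<le> card {\<lfloor>-X\<rfloor>..\<lfloor>X\<rfloor>}"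
    using inj by (metis card_image card_mono finite_atLeastAtMost_int)
  also have "\<dots> = nat (\<lfloor>X\<rfloor> - \<lfloor>-X\<rfloor> + 1)" by simp
  \<comment> \<open>Rounding gives at most \<open>2 * X + 2\<close> integers;
    \<open>X \<ge> 1\<close>, which comes from \<open>dl\<close>, absorbs the 2.\<close>
  finally have "real (card T) \<le> 4 * X" using X by linarith
  then show ?thesis by (simp add: X_def lP)
qed

text \<open>In the bound, the first factor counts the classes of points with equal \<open>g\<close>,
  and the second bounds the sum over one class. The latter is uniform because the volume of a box
  cancels between the number of its points and the size of the summand.\<close>

lemma sum_inverse_separated_le:
  fixes f :: "'a \<Rightarrow> 'm::finite \<Rightarrow> real"
  assumes S: "finite S" and d: "\<delta> > 0" "\<delta> \<le> 1"
    and le1: "\<And>x m. x \<in> S \<Longrightarrow> \<bar>f x m\<bar> \<le> 1"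
    and low: "\<And>x. x \<in> S \<Longrightarrow> \<delta> \<le> (\<Prod>m\<in>UNIV. \<bar>f x m\<bar>)"
    and sep: "\<And>x y. x \<in> S \<Longrightarrow> y \<in> S \<Longrightarrow> x \<noteq> y \<Longrightarrow> \<delta> \<le> (\<Prod>m\<in>UNIV. \<bar>f x m - f y m\<bar>)"
  shows "(\<Sum>x\<in>S. \<Prod>m\<in>UNIV. inverse \<bar>f x m\<bar>)
           \<le> (2 * (1 - ln \<delta>)) ^ CARD('m) * (4 * exp 1 ^ CARD('m) / \<delta>)"
proof -
  define j where "j x m = nat \<lfloor>- ln \<bar>f x m\<bar>\<rfloor>" for x m
  define g where "g x m = (j x m, f x m > 0)" for x m
  have nz: "f x m \<noteq> 0" if "x \<in> S" for x m
  proof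
    assume "f x m = 0"
    then have "(\<Prod>m\<in>UNIV. \<bar>f x m\<bar>) = 0" by (intro prod_zero) auto
    then show False using low[OF that] d by linarith
  qed
  have jb: "exp (- real (j x m) - 1) \<le> \<bar>f x m\<bar>" "\<bar>f x m\<bar> \<le> exp (- real (j x m))"
    if "x \<in> S" for x m
  proof -
    have "ln \<bar>f x m\<bar> \<le> 0" using le1[OF that] nz[OF that] by simp
    then have "- real (j x m) - 1 \<le> ln \<bar>f x m\<bar>" "ln \<bar>f x m\<bar> \<le> - real (j x m)"
      unfolding j_def by linarith+
    then show "exp (- real (j x m) - 1) \<le> \<bar>f x m\<bar>" "\<bar>f x m\<bar> \<le> exp (- real (j x m))"
      using nz[OF that, of m] by (metis exp_le_cancel_iff exp_ln zero_less_abs_iff)+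
  qed
  have El: "\<delta> \<le> (\<Prod>m\<in>UNIV. exp (- real (j x m)))" if "x \<in> S" for x
    using low[OF that] prod_mono[of UNIV "\<lambda>m. \<bar>f x m\<bar>" "\<lambda>m. exp (- real (j x m))"] jb[OF that]
    by force
  define B where "B = {..nat \<lfloor>- ln \<delta>\<rfloor>} \<times> (UNIV :: bool set)"
  have gB: "g ` S \<subseteq> (UNIV \<rightarrow>\<^sub>E B)"
  proof (intro image_subsetI)
    fix x assume x: "x \<in> S"
    have "j x m \<le> nat \<lfloor>- ln \<delta>\<rfloor>" for m
    proof -
      \<comment> \<open>The lower bound on the product controls only the sum of the exponents; since
        they are nonnegative, it controls each one.\<close>
      have "real (j x m) \<le> (\<Sum>m\<in>UNIV. real (j x m))"
        by (rule member_le_sum) auto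
      moreover have "\<delta> \<le> exp (- (\<Sum>m\<in>UNIV. real (j x m)))"
        using El[OF x] by (simp add: exp_sum sum_negf flip: sum_negf)
      then have "ln \<delta> \<le> - (\<Sum>m\<in>UNIV. real (j x m))"
        using d by (metis exp_gt_zero ln_exp ln_le_cancel_iff)
      ultimately have "real (j x m) \<le> - ln \<delta>" by linarith
      then show ?thesis by linarith
    qed
    then show "g x \<in> UNIV \<rightarrow>\<^sub>E B" by (auto simp: g_def B_def)
  qed
  have finB: "finite B" by (simp add: B_def)
  have "card (g ` S) \<le> card ((UNIV :: 'm set) \<rightarrow>\<^sub>E B)"
    by (rule card_mono[OF _ gB]) (simp add: finB finite_PiE)
  also have "\<dots> = card B ^ CARD('m)" by (simp add: card_funcsetE)
  finally have "real (card (g ` S)) \<le> real (card B) ^ CARD('m)"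
    by (metis of_nat_le_iff of_nat_power)
  also have "\<dots> \<le> (2 * (1 - ln \<delta>)) ^ CARD('m)"
  proof (rule power_mono)
    have "ln \<delta> \<le> 0" using d by simp
    then have "real (nat \<lfloor>- ln \<delta>\<rfloor>) \<le> - ln \<delta>" by linarith
    then show "real (card B) \<le> 2 * (1 - ln \<delta>)" by (simp add: B_def card_cartesian_product)
  qed simp
  finally have cardg: "real (card (g ` S)) \<le> (2 * (1 - ln \<delta>)) ^ CARD('m)" .
  define C where "C = 4 * exp 1 ^ CARD('m) / \<delta>"
  have block: "(\<Sum>x\<in>{x\<in>S. g x = y}. \<Prod>m\<in>UNIV. inverse \<bar>f x m\<bar>) \<le> C" if "y \<in> g ` S" for y
  proof -
    obtain z where z: "z \<in> S" "y = g z" using \<open>y \<in> g ` S\<close> by auto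
    define T where "T = {x\<in>S. g x = y}"
    define l where "l m = exp (- real (j z m))" for m
    have T: "x \<in> S" "j x m = j z m" "f x m > 0 \<longleftrightarrow> f z m > 0" if "x \<in> T" for x m
      using that z by (auto simp: T_def g_def fun_eq_iff)
    have bd: "\<bar>f x m\<bar> \<le> l m" if "x \<in> T" for x m
      using jb(2)[OF T(1)[OF that], of m] T(2)[OF that] by (simp add: l_def)
    have cT: "real (card T) \<le> 4 * (\<Prod>m\<in>UNIV. l m) / \<delta>"
    proof (rule card_separated_box_le[where f = f])
      show "\<delta> \<le> prod l UNIV" using El[OF z(1)] by (simp add: l_def)
      \<comment> \<open>This is why \<open>g\<close> records signs: on one side of 0 the difference
        is at most \<open>l m\<close> instead of \<open>2 * l m\<close>.\<close>
      show "\<bar>f x m - f y m\<bar> \<le> l m" if "x \<in> T" "y \<in> T" for x y m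
        using bd[OF that(1), of m] bd[OF that(2), of m] T(3)[OF that(1), of m] T(3)[OF that(2), of m]
        by linarith
    qed (use d bd T(1) sep in \<open>auto simp: l_def\<close>)
    have "(\<Prod>m\<in>UNIV. inverse \<bar>f x m\<bar>) \<le> exp 1 ^ CARD('m) / (\<Prod>m\<in>UNIV. l m)" if "x \<in> T" for x
    proof -
      \<comment> \<open>Rounding \<open>- ln\<close> down costs a factor of at most
        \<open>exp 1\<close> per coordinate.\<close>
      have "(\<Prod>m\<in>UNIV. inverse \<bar>f x m\<bar>) \<le> (\<Prod>m\<in>UNIV. exp 1 / l m)"
      proof (rule prod_mono, safe)
        fix m :: 'm
        have "exp (- real (j z m) - 1) \<le> \<bar>f x m\<bar>"
          using jb(1)[OF T(1)[OF that], of m] T(2)[OF that] by simp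
        then have "inverse \<bar>f x m\<bar> \<le> inverse (exp (- real (j z m) - 1))"
          by (rule le_imp_inverse_le) simp
        also have "\<dots> = exp 1 / l m" by (simp add: l_def exp_diff field_simps)
        finally show "inverse \<bar>f x m\<bar> \<le> exp 1 / l m" .
      qed simp
      then show ?thesis by (simp add: prod_dividef)
    qed
    then have "(\<Sum>x\<in>T. \<Prod>m\<in>UNIV. inverse \<bar>f x m\<bar>)
        \<le> real (card T) * (exp 1 ^ CARD('m) / (\<Prod>m\<in>UNIV. l m))"
      by (rule sum_bounded_above)
    also have "\<dots> \<le> (4 * (\<Prod>m\<in>UNIV. l m) / \<delta>) * (exp 1 ^ CARD('m) / (\<Prod>m\<in>UNIV. l m))"
      by (rule mult_right_mono[OF cT]) (simp add: l_def prod_nonneg)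
    also have "\<dots> = C" by (simp add: C_def l_def)
    finally show ?thesis by (simp add: T_def)
  qed
  have "(\<Sum>x\<in>S. \<Prod>m\<in>UNIV. inverse \<bar>f x m\<bar>)
      = (\<Sum>y\<in>g ` S. \<Sum>x\<in>{x\<in>S. g x = y}. \<Prod>m\<in>UNIV. inverse \<bar>f x m\<bar>)"
    by (rule sum.image_gen[OF S])
  also have "\<dots> \<le> real (card (g ` S)) * C" by (rule sum_bounded_above) (rule block)
  also have "\<dots> \<le> (2 * (1 - ln \<delta>)) ^ CARD('m) * C"
    by (rule mult_right_mono[OF cardg]) (use d in \<open>simp add: C_def\<close>)
  finally show ?thesis by (simp add: C_def)
qed

section \<open>From the circle to real representatives\<close>

lemma int_scale_diff: "int_scale (a - b) x = int_scale a x - int_scale b x"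
  unfolding minus_circle_def by transfer (simp add: algebra_simps)

lemma matrix_act_diff: "matrix_act A (\<xi> - \<eta>) $ m = matrix_act A \<xi> $ m - matrix_act A \<eta> $ m"
  by (simp add: matrix_act_def int_scale_diff sum_subtractf)

text \<open>The distance to the closed set of integers is attained. Subtracting a nearest integer
  leaves a signed representative, so the real-valued estimates apply.\<close>

lemma ex_rep_abs_eq_circle_norm: "\<exists>r. abs_circle r = x \<and> \<bar>r\<bar> = circle_norm x"
proof -
  obtain t where t: "x = abs_circle t" by (metis Quotient3_circle Quotient3_abs_rep)
  obtain k where k: "k \<in> \<int>" "infdist t \<int> = dist t k"
    using infdist_attains_inf[OF closed_Ints, of t] Ints_0 by blast
  have "abs_circle (t - k) = x"
    using k(1) by (simp add: t circle.abs_eq_iff)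
  moreover have "\<bar>t - k\<bar> = circle_norm x"
    by (simp add: t circle_norm.abs_eq k dist_real_def)
  ultimately show ?thesis by blast
qed

lemma circle_norm_abs_le: "circle_norm (abs_circle r) \<le> \<bar>r\<bar>"
  using infdist_le[of 0 "\<int>" r] by (simp add: circle_norm.abs_eq)

text \<open>Carries separation on the circle over to real representatives. Equality can fail, as
  \<open>r - s\<close> may be closer to a nonzero integer than to 0.\<close>

lemma circle_norm_diff_le: "circle_norm (abs_circle r - abs_circle s) \<le> \<bar>r - s\<bar>"
proof -
  have "abs_circle r - abs_circle s = abs_circle (r - s)"
    by (simp add: minus_circle_def plus_circle.abs_eq uminus_circle.abs_eq)
  then show ?thesis using circle_norm_abs_le by metis
qed

lemma circle_norm_le_1: "circle_norm x \<le> 1"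
proof -
  obtain t where t: "x = abs_circle t" by (metis Quotient3_circle Quotient3_abs_rep)
  have "infdist t \<int> \<le> dist t \<lfloor>t\<rfloor>" by (rule infdist_le) simp
  also have "\<dots> \<le> 1" by (simp add: dist_real_def) linarith
  finally show ?thesis by (simp add: t circle_norm.abs_eq)
qed

lemma circle_norm_nonneg: "0 \<le> circle_norm x"
  by transfer (rule infdist_nonneg)

section \<open>Size of the integer box\<close>

lemma
  fixes K :: "nat ^ 'n"
  shows finite_int_box: "finite (int_box K)"
    and card_int_box: "card (int_box K) = (\<Prod>n\<in>UNIV. K $ n + 1)"
proof -
  have eq: "int_box K = vec_lambda ` (\<Pi>\<^sub>E n\<in>UNIV. {0..int (K $ n)})"
  proof (intro equalityI subsetI)
    fix \<xi> assume "\<xi> \<in> int_box K"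
    then have "vec_nth \<xi> \<in> (\<Pi>\<^sub>E n\<in>UNIV. {0..int (K $ n)})" by (auto simp: int_box_def)
    then show "\<xi> \<in> vec_lambda ` (\<Pi>\<^sub>E n\<in>UNIV. {0..int (K $ n)})"
      by (metis image_eqI vec_nth_inverse)
  qed (auto simp: int_box_def)
  show "finite (int_box K)" unfolding eq by (intro finite_imageI finite_PiE) auto
  have "inj_on vec_lambda (\<Pi>\<^sub>E n\<in>UNIV. {0..int (K $ n)})"
    by (rule inj_onI) (simp add: vec_lambda_inject)
  then show "card (int_box K) = (\<Prod>n\<in>UNIV. K $ n + 1)"
    unfolding eq by (simp add: card_image card_PiE nat_add_distrib)
qed

lemma card_int_box_ge_2:
  fixes K :: "nat ^ 'n"
  assumes "K \<noteq> 0"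
  shows "card (int_box K) \<ge> 2"
proof -
  obtain n where "K $ n \<noteq> 0" using assms by (auto simp: vec_eq_iff)
  then have "2 \<le> K $ n + 1" by simp
  also have "\<dots> \<le> (\<Prod>n\<in>UNIV. K $ n + 1)"
    by (intro dvd_imp_le dvd_prodI prod_pos) auto
  finally show ?thesis by (simp add: card_int_box)
qed

lemma F_eq_prod_inverse:
  fixes x :: "circle ^ 'm"
  assumes "\<And>m. circle_norm (x $ m) \<noteq> 0"
  shows "F x = ennreal ((1/2) ^ CARD('m) * (\<Prod>m\<in>UNIV. inverse (circle_norm (x $ m))))"
  using assms prod.distrib[of "\<lambda>_. 1/2" "\<lambda>m. inverse (circle_norm (x $ m))" "UNIV :: 'm set"]
  by (simp add: F_def)

section \<open>The bound for the sum of \<open>F\<close>\<close>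

theorem theorem2p1:
  fixes A :: "circle ^ 'n ^ 'm"
  assumes "strongly_badly_approximable A"
  shows "\<exists>c>0. \<forall>K :: nat ^ 'n. K \<noteq> 0 \<longrightarrow>
    (\<Sum>\<xi> | \<xi> \<in> int_box K \<and> \<xi> \<noteq> 0. F (matrix_act A \<xi>))
      \<le> ennreal (c * real (card (int_box K)) * ln (2 * real (card (int_box K))) ^ CARD('m))"
proof -
  obtain \<gamma> where \<gamma>: "\<gamma> > 0" and sba: "\<And>\<xi> :: int ^ 'n. \<xi> \<noteq> 0 \<Longrightarrow>
      \<gamma> \<le> (\<Prod>m\<in>UNIV. circle_norm (matrix_act A \<xi> $ m)) * (\<Prod>n\<in>UNIV. (real_of_int \<bar>\<xi> $ n\<bar> + 1))"
    using assms unfolding strongly_badly_approximable_def matrix_act_def by auto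
  obtain r :: "circle \<Rightarrow> real" where r: "\<And>x. abs_circle (r x) = x" "\<And>x. \<bar>r x\<bar> = circle_norm x"
    using ex_rep_abs_eq_circle_norm by metis
  \<comment> \<open>The powers of \<open>1/2\<close> come from the 2 in \<open>F\<close>, the middle
    factor from comparing \<open>2 * (1 - ln \<delta>)\<close> with \<open>ln (2 * Q)\<close>, and
    the last from the bound for one class with \<open>\<delta> = \<gamma> / Q\<close>.\<close>
  define c where "c = (1/2) ^ CARD('m) * ((4 + 2 * \<bar>ln \<gamma>\<bar>) ^ CARD('m) * (4 * exp 1 ^ CARD('m) / \<gamma>))"
  have "c > 0" using \<gamma> by (simp add: c_def add_pos_nonneg)
  moreover have "(\<Sum>\<xi> | \<xi> \<in> int_box K \<and> \<xi> \<noteq> 0. F (matrix_act A \<xi>))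
      \<le> ennreal (c * real (card (int_box K)) * ln (2 * real (card (int_box K))) ^ CARD('m))"
    if K: "K \<noteq> 0" for K :: "nat ^ 'n"
  proof -
    define Q where "Q = real (card (int_box K))"
    have Q: "Q \<ge> 2" using card_int_box_ge_2[OF K] by (simp add: Q_def)
    define S where "S = {\<xi> \<in> int_box K. \<xi> \<noteq> 0}"
    define \<delta> where "\<delta> = \<gamma> / Q"
    have d: "\<delta> > 0" using \<gamma> Q by (simp add: \<delta>_def)
    \<comment> \<open>The condition on \<open>\<xi>\<close> is symmetric under sign change, so that
      it covers differences of box points as well as the points themselves.\<close>
    have low: "\<delta> \<le> (\<Prod>m\<in>UNIV. circle_norm (matrix_act A \<xi> $ m))"
      if "\<xi> \<noteq> 0" "\<And>n. \<bar>\<xi> $ n\<bar> \<le> int (K $ n)" for \<xi> :: "int ^ 'n"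
    proof -
      have "\<gamma> \<le> (\<Prod>m\<in>UNIV. circle_norm (matrix_act A \<xi> $ m)) * (\<Prod>n\<in>UNIV. (real_of_int \<bar>\<xi> $ n\<bar> + 1))"
        by (rule sba) fact
      also have "\<dots> \<le> (\<Prod>m\<in>UNIV. circle_norm (matrix_act A \<xi> $ m)) * (\<Prod>n\<in>UNIV. real (K $ n + 1))"
      proof (intro mult_left_mono prod_mono prod_nonneg conjI)
        fix n
        have "real_of_int \<bar>\<xi> $ n\<bar> \<le> real_of_int (int (K $ n))" using that(2) of_int_le_iff by blast
        then show "real_of_int \<bar>\<xi> $ n\<bar> + 1 \<le> real (K $ n + 1)" by simp
      qed (simp_all add: circle_norm_nonneg)
      also have "(\<Prod>n\<in>UNIV. real (K $ n + 1)) = Q"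
        by (simp only: Q_def card_int_box of_nat_prod)
      finally show ?thesis using Q by (simp add: \<delta>_def field_simps)
    qed
    have lowS: "\<delta> \<le> (\<Prod>m\<in>UNIV. circle_norm (matrix_act A \<xi> $ m))" if "\<xi> \<in> S" for \<xi>
      by (rule low) (use that in \<open>auto simp: S_def int_box_def\<close>)
    define f where "f \<xi> m = r (matrix_act A \<xi> $ m)" for \<xi> m
    have fin: "finite S" by (simp add: S_def finite_int_box)
    \<comment> \<open>The far corner of the box is a nonzero point; as circle norms are at most 1,
      its lower bound forces \<open>\<delta> \<le> 1\<close>.\<close>
    have "(\<chi> n. int (K $ n)) \<in> S" using K by (auto simp: S_def int_box_def vec_eq_iff)
    then have "\<delta> \<le> (\<Prod>m\<in>UNIV. circle_norm (matrix_act A (\<chi> n. int (K $ n)) $ m))" by (rule lowS)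
    also have "\<dots> \<le> 1" by (rule prod_le_1) (simp add: circle_norm_nonneg circle_norm_le_1)
    finally have d1: "\<delta> \<le> 1" .
    have main: "(\<Sum>\<xi>\<in>S. \<Prod>m\<in>UNIV. inverse \<bar>f \<xi> m\<bar>)
        \<le> (2 * (1 - ln \<delta>)) ^ CARD('m) * (4 * exp 1 ^ CARD('m) / \<delta>)"
    proof (rule sum_inverse_separated_le[OF fin d d1])
      show "\<bar>f \<xi> m\<bar> \<le> 1" for \<xi> m by (simp add: f_def r circle_norm_le_1)
      show "\<delta> \<le> (\<Prod>m\<in>UNIV. \<bar>f \<xi> m\<bar>)" if "\<xi> \<in> S" for \<xi>
        using lowS[OF that] by (simp add: f_def r)
      show "\<delta> \<le> (\<Prod>m\<in>UNIV. \<bar>f \<xi> m - f \<eta> m\<bar>)" if "\<xi> \<in> S" "\<eta> \<in> S" "\<xi> \<noteq> \<eta>" for \<xi> \<eta>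
      proof -
        have bounds: "0 \<le> \<xi> $ n" "\<xi> $ n \<le> int (K $ n)" "0 \<le> \<eta> $ n" "\<eta> $ n \<le> int (K $ n)" for n
          using that by (auto simp: S_def int_box_def)
        have "\<bar>(\<xi> - \<eta>) $ n\<bar> \<le> int (K $ n)" for n
          using bounds[of n] by simp
        then have "\<delta> \<le> (\<Prod>m\<in>UNIV. circle_norm (matrix_act A (\<xi> - \<eta>) $ m))"
          by (intro low) (use that in auto)
        also have "\<dots> \<le> (\<Prod>m\<in>UNIV. \<bar>f \<xi> m - f \<eta> m\<bar>)"
        proof (intro prod_mono conjI circle_norm_nonneg)
          show "circle_norm (matrix_act A (\<xi> - \<eta>) $ m) \<le> \<bar>f \<xi> m - f \<eta> m\<bar>" for m
            using circle_norm_diff_le[of "f \<xi> m" "f \<eta> m"] by (simp add: matrix_act_diff f_def r)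
        qed
        finally show ?thesis .
      qed
    qed
    have "F (matrix_act A \<xi>) = ennreal ((1/2) ^ CARD('m) * (\<Prod>m\<in>UNIV. inverse \<bar>f \<xi> m\<bar>))"
      if "\<xi> \<in> S" for \<xi>
    proof -
      \<comment> \<open>A positive product rules out the infinite value of \<open>F\<close>.\<close>
      have "(\<Prod>m\<in>UNIV. circle_norm (matrix_act A \<xi> $ m)) \<noteq> 0" using lowS[OF that] d by linarith
      then show ?thesis by (subst F_eq_prod_inverse) (auto simp: f_def r)
    qed
    then have "(\<Sum>\<xi>\<in>S. F (matrix_act A \<xi>))
        = (\<Sum>\<xi>\<in>S. ennreal ((1/2) ^ CARD('m) * (\<Prod>m\<in>UNIV. inverse \<bar>f \<xi> m\<bar>)))"
      by simp
    also have "\<dots> = ennreal ((1/2) ^ CARD('m) * (\<Sum>\<xi>\<in>S. \<Prod>m\<in>UNIV. inverse \<bar>f \<xi> m\<bar>))"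
      by (subst sum_ennreal) (auto simp: sum_distrib_left prod_nonneg)
    also have "\<dots> \<le> ennreal (c * Q * ln (2 * Q) ^ CARD('m))"
    proof (rule ennreal_leI)
      have "exp 1 \<le> (4::real)" using exp_le by linarith
      also have "4 \<le> 2 * Q" using Q by simp
      finally have L: "1 \<le> ln (2 * Q)" using Q by (simp add: ln_ge_iff)
      have "ln Q \<le> ln (2 * Q)" using Q by simp
      moreover have "\<bar>ln \<gamma>\<bar> * 1 \<le> \<bar>ln \<gamma>\<bar> * ln (2 * Q)" by (rule mult_left_mono[OF L]) simp
      moreover have "ln \<delta> = ln \<gamma> - ln Q" using \<gamma> Q by (simp add: \<delta>_def ln_div)
      \<comment> \<open>Here \<open>1 - ln \<delta> = 1 - ln \<gamma> + ln Q\<close>, and the three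
        terms are at most \<open>1\<close>, \<open>\<bar>ln \<gamma>\<bar>\<close> and
        \<open>1\<close> times \<open>ln (2 * Q)\<close>, because
        \<open>ln (2 * Q) \<ge> 1\<close>.\<close>
      ultimately have "2 * (1 - ln \<delta>) \<le> (4 + 2 * \<bar>ln \<gamma>\<bar>) * ln (2 * Q)"
        using L by (simp add: algebra_simps)
      moreover have "ln \<delta> \<le> 0" using d d1 by simp
      ultimately have "(2 * (1 - ln \<delta>)) ^ CARD('m) \<le> ((4 + 2 * \<bar>ln \<gamma>\<bar>) * ln (2 * Q)) ^ CARD('m)"
        by (intro power_mono) auto
      then have "(2 * (1 - ln \<delta>)) ^ CARD('m) * (4 * exp 1 ^ CARD('m) / \<delta>)
          \<le> ((4 + 2 * \<bar>ln \<gamma>\<bar>) * ln (2 * Q)) ^ CARD('m) * (4 * exp 1 ^ CARD('m) / \<delta>)"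
        by (rule mult_right_mono) (use d in simp)
      with main have "(\<Sum>\<xi>\<in>S. \<Prod>m\<in>UNIV. inverse \<bar>f \<xi> m\<bar>)
          \<le> ((4 + 2 * \<bar>ln \<gamma>\<bar>) * ln (2 * Q)) ^ CARD('m) * (4 * exp 1 ^ CARD('m) / \<delta>)"
        by linarith
      then have "(1/2) ^ CARD('m) * (\<Sum>\<xi>\<in>S. \<Prod>m\<in>UNIV. inverse \<bar>f \<xi> m\<bar>)
          \<le> (1/2) ^ CARD('m) * (((4 + 2 * \<bar>ln \<gamma>\<bar>) * ln (2 * Q)) ^ CARD('m) * (4 * exp 1 ^ CARD('m) / \<delta>))"
        by (rule mult_left_mono) simp
      \<comment> \<open>The factor \<open>Q\<close> is the one in
        \<open>1 / \<delta> = Q / \<gamma>\<close>.\<close>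
      also have "\<dots> = c * Q * ln (2 * Q) ^ CARD('m)"
        by (simp add: c_def \<delta>_def power_mult_distrib)
      finally show "(1/2) ^ CARD('m) * (\<Sum>\<xi>\<in>S. \<Prod>m\<in>UNIV. inverse \<bar>f \<xi> m\<bar>)
          \<le> c * Q * ln (2 * Q) ^ CARD('m)" .
    qed
    finally show ?thesis by (simp add: S_def Q_def)
  qed
  ultimately show ?thesis by blast
qed

end
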